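(* Let $\mathcal I$ be a nonempty set, $(X_\iota)_{\iota\in\mathcal I}$ a family of nonempty sets, and $X=\prod_{\iota\in\mathcal I}X_\iota$. Let $(P_\jmath)_{\jmath\in\mathcal J}$ be a family of predicates on $X$, and let $P$ be the predicate on $X$ such that $P(x)$ holds iff $P_\jmath(x)$ holds for all $\jmath\in\mathcal J$. Suppose $|\mathcal J|\le|\mathcal I|$ and let $q:\mathcal J\to\mathcal I$ be an injection. For $x\in X$, $\iota\in\mathcal I$, $\jmath\in\mathcal J$ put $$\mathcal B_{\iota\jmath}(x)=\{y\in X_\iota\mid P_\jmath((y,x_{-\iota}))\},\qquad \mathcal B_\iota(x)=\begin{cases}\mathcal B_{\iota\,q^{-1}(\iota)}(x),&\iota\in q(\mathcal J),\\ X_\iota,&\iota\notin q(\mathcal J),\end{cases}$$ and define $\mathcal F_P:X\to\mathcal P(X)$ by $\mathcal F_P(x)=\prod_{\iota\in\mathcal I}\mathcal B_\iota(x)$. Then $\mathcal F_P\in\mathfrak{UM}(P)$.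
   Context: $\mathcal P(X)$ is the power set of $X$. A predicate on $X$ is a function $P:X\to\{0,1\}$; $P(x)$ holds iff $P(x)=1$, and $P^{-1}(1)=\{x\in X\mid P(x)=1\}$. $\mathfrak{UM}(P)$ is the set of all multifunctions $f:X\to\mathcal P(X)$ such that $\{x\in X\mid x\in f(x)\}=P^{-1}(1)$. For $x\in X$, $\iota\in\mathcal I$ and $y\in X_\iota$, $(y,x_{-\iota})$ is the element of $X$ obtained from $x$ by replacing its $\iota$-th coordinate by $y$. For $\iota\in q(\mathcal J)$, $q^{-1}(\iota)$ denotes the unique $\jmath\in\mathcal J$ with $q(\jmath)=\iota$. The axiom of choice is assumed. *)

theory Defs
  imports Main "HOL-Library.FuncSet" "HOL-Library.Equipollence"
begin

text \<open>
  The product of a family \<open>Xs\<close> of sets over \<open>I\<close> is \<open>PiE I Xs\<close>, whose elements are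
  \<open>undefined\<close> outside \<open>I\<close>; for \<open>x\<close> in it, \<open>\<iota> \<in> I\<close> and \<open>y \<in> Xs \<iota>\<close>, the element obtained by
  replacing the \<open>\<iota>\<close>-th coordinate is \<open>x(\<iota> := y)\<close>. A predicate on \<open>X\<close> is a \<open>bool\<close>-valued
  function, of which only the values on \<open>X\<close> are relevant; a multifunction on \<open>X\<close> is an
  element of \<open>X \<rightarrow>\<^sub>E Pow X\<close>.
\<close>

definition UM :: "'x set \<Rightarrow> ('x \<Rightarrow> bool) \<Rightarrow> ('x \<Rightarrow> 'x set) set" where
  "UM X P = {f \<in> X \<rightarrow>\<^sub>E Pow X. {x \<in> X. x \<in> f x} = {x \<in> X. P x}}"

definition coord_section ::
  "('i \<Rightarrow> 'a set) \<Rightarrow> ('j \<Rightarrow> ('i \<Rightarrow> 'a) \<Rightarrow> bool) \<Rightarrow> 'i \<Rightarrow> 'j \<Rightarrow> ('i \<Rightarrow> 'a) \<Rightarrow> 'a set" where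
  "coord_section Xs Ps \<iota> j x = {y \<in> Xs \<iota>. Ps j (x(\<iota> := y))}"

definition coord_response ::
  "('i \<Rightarrow> 'a set) \<Rightarrow> 'j set \<Rightarrow> ('j \<Rightarrow> ('i \<Rightarrow> 'a) \<Rightarrow> bool) \<Rightarrow> ('j \<Rightarrow> 'i) \<Rightarrow> 'i \<Rightarrow> ('i \<Rightarrow> 'a) \<Rightarrow> 'a set" where
  "coord_response Xs J Ps q \<iota> x =
     (if \<iota> \<in> q ` J then coord_section Xs Ps \<iota> (the_inv_into J q \<iota>) x else Xs \<iota>)"

definition response_map ::
  "'i set \<Rightarrow> ('i \<Rightarrow> 'a set) \<Rightarrow> 'j set \<Rightarrow> ('j \<Rightarrow> ('i \<Rightarrow> 'a) \<Rightarrow> bool) \<Rightarrow> ('j \<Rightarrow> 'i)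
    \<Rightarrow> ('i \<Rightarrow> 'a) \<Rightarrow> ('i \<Rightarrow> 'a) set" where
  "response_map I Xs J Ps q = (\<lambda>x \<in> PiE I Xs. PiE I (\<lambda>\<iota>. coord_response Xs J Ps q \<iota> x))"

end

theory Submission
  imports Defs
begin

text \<open>
  A point \<open>x\<close> is fixed by the response map iff each coordinate \<open>x \<iota>\<close> is a response to \<open>x\<close>.
  Putting \<open>x \<iota>\<close> in the \<open>\<iota>\<close>-th place of \<open>x\<close> changes nothing, so at \<open>\<iota> = q j\<close> this says that
  \<open>Ps j x\<close> holds. As \<open>q\<close> is injective, each predicate of the family has a coordinate of its own
  that tests it; the remaining coordinates impose no condition. Hence the fixed points are
  exactly the points at which all predicates of the family hold.
\<close>

lemma coord_response_subset: "coord_response Xs J Ps q \<iota> x \<subseteq> Xs \<iota>"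
  by (auto simp: coord_response_def coord_section_def)

lemma own_coord_in_coord_section_iff:
  assumes "x \<iota> \<in> Xs \<iota>"
  shows "x \<iota> \<in> coord_section Xs Ps \<iota> j x \<longleftrightarrow> Ps j x"
  using assms by (simp add: coord_section_def)

text \<open>
  By injectivity, \<open>the_inv_into J q (q j) = j\<close>, so the coordinate \<open>q j\<close> tests \<open>Ps j\<close> and no other
  predicate; the range condition on \<open>q\<close> places that coordinate among those of the product.
\<close>

lemma mem_response_map_self_iff:
  assumes x: "x \<in> PiE I Xs" and q: "q \<in> J \<rightarrow> I" and inj: "inj_on q J"
  shows "x \<in> response_map I Xs J Ps q x \<longleftrightarrow> (\<forall>j\<in>J. Ps j x)"
proof -
  have at_q: "x (q j) \<in> coord_response Xs J Ps q (q j) x \<longleftrightarrow> Ps j x" if "j \<in> J" for j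
  proof -
    have "x (q j) \<in> Xs (q j)"
      using x q that by auto
    then show ?thesis
      using that inj
      by (simp add: coord_response_def the_inv_into_f_f own_coord_in_coord_section_iff)
  qed
  have off_q: "x \<iota> \<in> coord_response Xs J Ps q \<iota> x" if "\<iota> \<in> I" "\<iota> \<notin> q ` J" for \<iota>
    using x that by (auto simp: coord_response_def)
  have "x \<in> response_map I Xs J Ps q x \<longleftrightarrow> (\<forall>\<iota>\<in>I. x \<iota> \<in> coord_response Xs J Ps q \<iota> x)"
  proof -
    have "x \<in> extensional I"
      using x by (simp add: PiE_iff)
    then show ?thesis
      unfolding response_map_def restrict_apply'[OF x] by (simp add: PiE_iff)
  qed
  also have "\<dots> \<longleftrightarrow> (\<forall>j\<in>J. x (q j) \<in> coord_response Xs J Ps q (q j) x)"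
  proof
    assume "\<forall>\<iota>\<in>I. x \<iota> \<in> coord_response Xs J Ps q \<iota> x"
    then show "\<forall>j\<in>J. x (q j) \<in> coord_response Xs J Ps q (q j) x"
      using q by auto
  next
    assume *: "\<forall>j\<in>J. x (q j) \<in> coord_response Xs J Ps q (q j) x"
    show "\<forall>\<iota>\<in>I. x \<iota> \<in> coord_response Xs J Ps q \<iota> x"
    proof
      fix \<iota> assume "\<iota> \<in> I"
      then show "x \<iota> \<in> coord_response Xs J Ps q \<iota> x"
        using * off_q[of \<iota>] by (cases "\<iota> \<in> q ` J") auto
    qed
  qed
  also have "\<dots> \<longleftrightarrow> (\<forall>j\<in>J. Ps j x)"
    using at_q by simp
  finally show ?thesis .
qed

theorem lemma3p5:
  fixes I :: "'i set" and Xs :: "'i \<Rightarrow> 'a set" and J :: "'j set"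
    and Ps :: "'j \<Rightarrow> ('i \<Rightarrow> 'a) \<Rightarrow> bool" and P :: "('i \<Rightarrow> 'a) \<Rightarrow> bool" and q :: "'j \<Rightarrow> 'i"
  assumes "I \<noteq> {}"
    and "\<And>\<iota>. \<iota> \<in> I \<Longrightarrow> Xs \<iota> \<noteq> {}"
    and "\<And>x. x \<in> PiE I Xs \<Longrightarrow> P x \<longleftrightarrow> (\<forall>j\<in>J. Ps j x)"
    and "J \<lesssim> I"
    and "q \<in> J \<rightarrow> I"
    and "inj_on q J"
  shows "response_map I Xs J Ps q \<in> UM (PiE I Xs) P"
proof -
  have "response_map I Xs J Ps q \<in> PiE I Xs \<rightarrow>\<^sub>E Pow (PiE I Xs)"
    unfolding response_map_def restrict_PiE_iff
    by (simp add: PiE_mono coord_response_subset)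
  moreover have "{x \<in> PiE I Xs. x \<in> response_map I Xs J Ps q x} = {x \<in> PiE I Xs. P x}"
    using assms(3) by (simp add: mem_response_map_self_iff[OF _ assms(5,6)] cong: conj_cong)
  ultimately show ?thesis
    by (simp add: UM_def)
qed

end
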